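(* For every integer $k \geq 2$, the general continued fraction with sequences $n \mapsto (n-1)^k + n^k$ and $n \mapsto -n^{2k}$ ($n \geq 1$) exists and $$[(n - 1)^k + n^k : -n^{2k}] = \frac{1}{\zeta(k)},$$ where $\zeta$ is the Riemann zeta function.
   Context: Given two sequences $a(n)$ and $b(n)$ ($n \geq 1$) and an integer $m \geq 1$, the $m$th convergent of their general continued fraction is defined recursively by $[a(n) : b(n)]_1 = a(1)$ and $$[a(n) : b(n)]_{m+1} = a(1) + \frac{b(1)}{[a(n+1) : b(n+1)]_m}, \quad m \geq 1,$$ whenever these expressions are well-defined (no division by zero occurs in the nested expression); here $[a(n+1):b(n+1)]_m$ is the $m$th convergent for the shifted sequences $n \mapsto a(n+1)$, $n \mapsto b(n+1)$. If all convergents are well-defined and $\lim_{m\to\infty} [a(n):b(n)]_m$ exists, the general continued fraction is $$[a(n) : b(n)] = \lim_{m \to \infty} [a(n):b(n)]_m = a(1) + \cfrac{b(1)}{a(2) + \cfrac{b(2)}{a(3) + \cdots}}.$$ In this notation $n$ is always the sequence variable and other letters are parameters. *)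

theory Defs
  imports "HOL-Analysis.Analysis"
begin

text \<open>
  Sequences are indexed from \<open>1\<close>: the values \<open>a 0\<close> and \<open>b 0\<close> are never used. Likewise convergents
  are numbered from \<open>1\<close>, and \<open>gcf_conv a b 0\<close> is left unspecified.
\<close>

fun gcf_conv :: "(nat \<Rightarrow> 'a::field) \<Rightarrow> (nat \<Rightarrow> 'a) \<Rightarrow> nat \<Rightarrow> 'a" where
  "gcf_conv a b (Suc 0) = a 1"
| "gcf_conv a b (Suc (Suc m)) =
     a 1 + b 1 / gcf_conv (\<lambda>n. a (n + 1)) (\<lambda>n. b (n + 1)) (Suc m)"

text \<open>
  Since \<open>x / 0 = 0\<close> in the library, that no division by zero occurs anywhere in the nested
  expression has to be tracked separately.
\<close>

fun gcf_conv_defined :: "(nat \<Rightarrow> 'a::field) \<Rightarrow> (nat \<Rightarrow> 'a) \<Rightarrow> nat \<Rightarrow> bool" where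
  "gcf_conv_defined a b 0 = False"
| "gcf_conv_defined a b (Suc 0) = True"
| "gcf_conv_defined a b (Suc (Suc m)) =
     (gcf_conv_defined (\<lambda>n. a (n + 1)) (\<lambda>n. b (n + 1)) (Suc m) \<and>
      gcf_conv (\<lambda>n. a (n + 1)) (\<lambda>n. b (n + 1)) (Suc m) \<noteq> 0)"

definition gcf_exists :: "(nat \<Rightarrow> 'a::real_normed_field) \<Rightarrow> (nat \<Rightarrow> 'a) \<Rightarrow> bool" where
  "gcf_exists a b \<longleftrightarrow> (\<forall>m\<ge>1. gcf_conv_defined a b m) \<and> convergent (gcf_conv a b)"

definition gcf :: "(nat \<Rightarrow> 'a::real_normed_field) \<Rightarrow> (nat \<Rightarrow> 'a) \<Rightarrow> 'a" where
  "gcf a b = lim (gcf_conv a b)"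

text \<open>
  The Riemann zeta function on the half-plane \<open>Re s > 1\<close>, where it is defined by its (absolutely
  convergent) Dirichlet series. The analytic continuation is not provided: for \<open>Re s \<le> 1\<close> the
  value of this constant carries no meaning.
\<close>

definition riemann_zeta :: "complex \<Rightarrow> complex" where
  "riemann_zeta s = (\<Sum>n. 1 / of_nat (Suc n) powr s)"

end

theory Submission
  imports Defs
begin

text \<open>
  For \<open>a n = x (n - 1) + x n\<close> and \<open>b n = - (x n)\<^sup>2\<close> with positive \<open>x\<close>, the continued fraction
  collapses (as in Euler's transformation of a series): its \<open>m\<close>-th convergent is \<open>x 0\<close> plus the
  reciprocal of the \<open>m\<close>-th partial sum of \<open>\<Sum> 1 / x n\<close>. Taking \<open>x n = n ^ k\<close> gives the reciprocals
  of the partial sums of \<open>\<zeta>(k)\<close>.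
\<close>

lemma gcf_conv_telescoping:
  fixes a b x :: "nat \<Rightarrow> 'a::linordered_field"
  assumes "\<And>n. a (Suc n) = x n + x (Suc n)" "\<And>n. b (Suc n) = - (x (Suc n))\<^sup>2"
    and "\<And>n. x (Suc n) > 0"
  shows "gcf_conv_defined a b (Suc m) \<and>
    gcf_conv a b (Suc m) = x 0 + 1 / (\<Sum>j\<le>m. 1 / x (Suc j))"
  using assms
\<comment> \<open>The tail of the fraction has the same shape for the shifted \<open>x\<close>, so
  all three sequences vary in the induction.\<close>
proof (induction m arbitrary: a b x)
  case 0
  show ?case using "0.prems"(1)[of 0] by simp
next
  case (Suc m)
  define T where "T = (\<Sum>j\<le>m. 1 / x (Suc (Suc j)))"
  have IH: "gcf_conv_defined (\<lambda>n. a (n + 1)) (\<lambda>n. b (n + 1)) (Suc m)"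
    "gcf_conv (\<lambda>n. a (n + 1)) (\<lambda>n. b (n + 1)) (Suc m) = x 1 + 1 / T"
    using Suc.IH[of "\<lambda>n. a (n + 1)" "\<lambda>n. x (n + 1)" "\<lambda>n. b (n + 1)"] Suc.prems
    by (simp_all add: T_def)
  have x1: "x 1 > 0" using Suc.prems(3)[of 0] by simp
  have T: "T > 0" unfolding T_def by (intro sum_pos) (auto simp: Suc.prems(3))
  \<comment> \<open>\<open>x 1 + 1 / T\<close> is the convergent of the tail; its positivity
    excludes division by zero.\<close>
  have pos: "x 1 + 1 / T > 0" "x 1 * T + 1 > 0"
    using x1 T by (auto intro!: add_pos_pos)
  \<comment> \<open>Both sides exceed \<open>x 0\<close> by
    \<open>x 1 / (x 1 * T + 1)\<close>.\<close>
  have "x 0 + x 1 + - (x 1)\<^sup>2 / (x 1 + 1 / T) = x 0 + 1 / (1 / x 1 + T)"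
  proof -
    have "x 1 + 1 / T = (x 1 * T + 1) / T" "1 / x 1 + T = (x 1 * T + 1) / x 1"
      using x1 T by (simp_all add: field_simps)
    then show ?thesis using pos(2) by (simp add: field_simps power2_eq_square)
  qed
  moreover have "(\<Sum>j\<le>Suc m. 1 / x (Suc j)) = 1 / x 1 + T"
    by (subst sum.atMost_Suc_shift) (simp add: T_def)
  ultimately show ?case
    using IH pos(1) Suc.prems(1,2)[of 0] by simp
qed

theorem theorem3:
  fixes k :: nat
  assumes "k \<ge> 2"
  shows "gcf_exists (\<lambda>n. (real n - 1) ^ k + real n ^ k) (\<lambda>n. - (real n ^ (2 * k))) \<and>
    complex_of_real (gcf (\<lambda>n. (real n - 1) ^ k + real n ^ k) (\<lambda>n. - (real n ^ (2 * k)))) =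
      1 / riemann_zeta (of_nat k)"
proof -
  let ?a = "\<lambda>n. (real n - 1) ^ k + real n ^ k"
  let ?b = "\<lambda>n. - (real n ^ (2 * k))"
  let ?f = "\<lambda>j. 1 / real (Suc j) ^ k"
  \<comment> \<open>Keeping \<open>real 0 ^ k\<close> unsimplified lets unification find
    \<open>x n = real n ^ k\<close>; it vanishes later because \<open>k\<close> is positive.\<close>
  have conv: "gcf_conv_defined ?a ?b (Suc m) \<and>
      gcf_conv ?a ?b (Suc m) = real 0 ^ k + 1 / (\<Sum>j\<le>m. ?f j)" for m
    by (rule gcf_conv_telescoping) (auto simp: power_mult[symmetric] mult.commute)
  have summ: "summable ?f"
    using inverse_power_summable[OF assms, where 'a = real]
    by (subst (asm) summable_Suc_iff[symmetric]) (simp add: field_simps)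
  have pos: "suminf ?f > 0"
    by (intro suminf_pos summ) auto
  have "(\<lambda>m. 1 / (\<Sum>j\<le>m. ?f j)) \<longlonglongrightarrow> 1 / suminf ?f"
    using pos by (intro tendsto_intros summable_LIMSEQ' summ) auto
  then have "(\<lambda>m. gcf_conv ?a ?b (Suc m)) \<longlonglongrightarrow> 1 / suminf ?f"
    using conv assms by (simp add: power_0_left)
  \<comment> \<open>The unspecified convergent at index 0 does not affect the limit.\<close>
  then have lim: "gcf_conv ?a ?b \<longlonglongrightarrow> 1 / suminf ?f"
    by (rule LIMSEQ_imp_Suc)
  have "riemann_zeta (of_nat k) = (\<Sum>n. complex_of_real (?f n))"
    unfolding riemann_zeta_def
    by (intro arg_cong[where f = suminf] ext)
      (simp add: powr_nat' del: of_nat_Suc)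
  also have "\<dots> = complex_of_real (suminf ?f)"
    by (rule suminf_of_real[OF summ, symmetric])
  finally have zeta: "riemann_zeta (of_nat k) = complex_of_real (suminf ?f)" .
  have "gcf_conv_defined ?a ?b m" if "m \<ge> 1" for m
    using conv[of "m - 1"] that by simp
  then show ?thesis
    using lim zeta by (auto simp: gcf_exists_def gcf_def convergent_def limI)
qed

end
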